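(* Fix an integer $c\ge1$. Then the worst-case ratio between $OPT_{c\text{-}BLZ}({\bf s})$ and $OPT_{LZ}({\bf s})$ over ternary strings is unbounded: for every real $M$ there exists a nonempty string ${\bf s}\in\{1,2,3\}^*$ with $OPT_{c\text{-}BLZ}({\bf s})/OPT_{LZ}({\bf s})>M$.
   Context: For ${\bf s}=s_1\dots s_N$, ${\bf s}[i,j]=s_i\dots s_j$. A parsing of ${\bf s}$ is a partition into consecutive nonempty substrings (phrases); its size is the number of phrases. An LZ-parsing is a parsing in which every phrase ${\bf s}[a,e]$ either has length $1$, or is given together with a chosen source start $b$ with $1\le b\le a-1$ and ${\bf s}[b,b+(e-a)-1]={\bf s}[a,e-1]$ (overlap allowed); each position $a+t$, $0\le t\le e-a-1$, then has source position $b+(t\bmod(a-b))$. The hop-number of position $p$ is $0$ if $p$ is the last position of a phrase and $hop(q)+1$ otherwise, where $q$ is the source position of $p$. A $c$-BLZ parsing is an LZ-parsing in which every hop-number is at most $c$. $OPT_{LZ}({\bf s})$ is the minimum size of an LZ-parsing of ${\bf s}$, and $OPT_{c\text{-}BLZ}({\bf s})$ is the minimum size of a $c$-BLZ parsing of ${\bf s}$. *)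

theory Defs
  imports Complex_Main
begin

text \<open>Positions in a string are numbered from 1: position \<open>k\<close> of \<open>s\<close> holds the letter \<open>s ! (k - 1)\<close>.\<close>

definition substring :: "'a list \<Rightarrow> nat \<Rightarrow> nat \<Rightarrow> 'a list" where
  "substring s i j = map (\<lambda>k. s ! (k - 1)) [i..<Suc j]"

definition parsing :: "'a list \<Rightarrow> 'a list list \<Rightarrow> bool" where
  "parsing s ps \<longleftrightarrow> concat ps = s \<and> (\<forall>x\<in>set ps. x \<noteq> [])"

text \<open>The phrases of \<open>ps\<close> are indexed from 0; phrase \<open>i\<close> occupies the positions
  from \<open>phrase_start ps i\<close> to \<open>phrase_end ps i\<close>, both inclusive.\<close>

definition phrase_start :: "'a list list \<Rightarrow> nat \<Rightarrow> nat" where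
  "phrase_start ps i = Suc (length (concat (take i ps)))"

definition phrase_end :: "'a list list \<Rightarrow> nat \<Rightarrow> nat" where
  "phrase_end ps i = length (concat (take (Suc i) ps))"

text \<open>\<open>src i\<close> is the source start chosen for phrase \<open>i\<close>; its value is irrelevant if that
  phrase has length 1.\<close>

definition LZ_parsing :: "'a list \<Rightarrow> 'a list list \<Rightarrow> (nat \<Rightarrow> nat) \<Rightarrow> bool" where
  "LZ_parsing s ps src \<longleftrightarrow> parsing s ps \<and>
     (\<forall>i<length ps. length (ps ! i) = 1 \<or>
        (let a = phrase_start ps i; e = phrase_end ps i; b = src i
         in 1 \<le> b \<and> b \<le> a - 1 \<and> substring s b (b + (e - a) - 1) = substring s a (e - 1)))"

text \<open>\<open>hop_number ps src p h\<close>: position \<open>p\<close> has hop-number \<open>h\<close>. For LZ-parsings this relation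
  is a total function on positions, see \<open>hop_number_ex1\<close> below.\<close>

inductive hop_number :: "'a list list \<Rightarrow> (nat \<Rightarrow> nat) \<Rightarrow> nat \<Rightarrow> nat \<Rightarrow> bool"
  for ps :: "'a list list" and src :: "nat \<Rightarrow> nat" where
  last: "i < length ps \<Longrightarrow> hop_number ps src (phrase_end ps i) 0"
| step: "i < length ps \<Longrightarrow> a = phrase_start ps i \<Longrightarrow> b = src i \<Longrightarrow>
    a + t < phrase_end ps i \<Longrightarrow> hop_number ps src (b + t mod (a - b)) h \<Longrightarrow>
    hop_number ps src (a + t) (Suc h)"

definition BLZ_parsing :: "nat \<Rightarrow> 'a list \<Rightarrow> 'a list list \<Rightarrow> (nat \<Rightarrow> nat) \<Rightarrow> bool" where
  "BLZ_parsing c s ps src \<longleftrightarrow> LZ_parsing s ps src \<and>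
     (\<forall>p\<in>{1..length s}. \<exists>h\<le>c. hop_number ps src p h)"

definition OPT_LZ :: "'a list \<Rightarrow> nat" where
  "OPT_LZ s = (LEAST k. \<exists>ps src. LZ_parsing s ps src \<and> length ps = k)"

definition OPT_BLZ :: "nat \<Rightarrow> 'a list \<Rightarrow> nat" where
  "OPT_BLZ c s = (LEAST k. \<exists>ps src. BLZ_parsing c s ps src \<and> length ps = k)"

lemma phrase_start_mono: "i \<le> j \<Longrightarrow> phrase_start ps i \<le> phrase_start ps j"
proof (induction rule: dec_induct)
  case (step n)
  have "length (concat (take n ps)) \<le> length (concat (take (Suc n) ps))"
    by (cases "n < length ps") (simp_all add: take_Suc_conv_app_nth)
  with step show ?case by (simp add: phrase_start_def)
qed simp

lemma phrase_end_conv: "Suc (phrase_end ps i) = phrase_start ps (Suc i)"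
  by (simp add: phrase_start_def phrase_end_def)

lemma phrase_length:
  assumes "i < length ps"
  shows "phrase_start ps i + length (ps ! i) = Suc (phrase_end ps i)"
  using assms by (simp add: phrase_start_def phrase_end_def take_Suc_conv_app_nth)

lemma phrase_index_unique:
  assumes "phrase_start ps i \<le> p" "p \<le> phrase_end ps i"
    and "phrase_start ps j \<le> p" "p \<le> phrase_end ps j"
  shows "i = j"
proof -
  have False if "k < l" "phrase_start ps l \<le> p" "p \<le> phrase_end ps k" for k l
    using phrase_start_mono[of "Suc k" l ps] phrase_end_conv[of ps k] that by simp
  then show ?thesis using assms by (meson linorder_neqE_nat)
qed

lemma phrase_index_exists:
  assumes "1 \<le> p" "p \<le> length (concat ps)"
  shows "\<exists>i<length ps. phrase_start ps i \<le> p \<and> p \<le> phrase_end ps i"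
proof -
  define n where "n = (LEAST n. p < phrase_start ps n)"
  have "p < phrase_start ps (length ps)"
    using assms by (simp add: phrase_start_def)
  then have n: "p < phrase_start ps n" "n \<le> length ps"
    unfolding n_def by (rule LeastI, rule Least_le)
  have "n \<noteq> 0" using n(1) assms by (intro notI) (simp add: phrase_start_def)
  then obtain i where i: "n = Suc i" by (cases n) auto
  have "\<not> p < phrase_start ps i"
    using i not_less_Least[of i "\<lambda>n. p < phrase_start ps n"] n_def by simp
  then show ?thesis using n i phrase_end_conv[of ps i] by (intro exI[of _ i]) simp
qed

lemma hop_number_ex1:
  assumes LZ: "LZ_parsing s ps src"
  shows "p \<in> {1..length s} \<Longrightarrow> \<exists>!h. hop_number ps src p h"
proof (induction p rule: less_induct)
  case (less p)
  have s: "concat ps = s" using LZ by (simp add: LZ_parsing_def parsing_def)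
  have start_le: "phrase_start ps j \<le> phrase_end ps j" if "j < length ps" for j
  proof -
    have "ps ! j \<noteq> []" using LZ that by (simp add: LZ_parsing_def parsing_def)
    then have "length (ps ! j) > 0" by simp
    then show ?thesis using phrase_length[OF that] by linarith
  qed
  obtain i where i: "i < length ps" "phrase_start ps i \<le> p" "p \<le> phrase_end ps i"
    using phrase_index_exists[of p ps] less.prems s by auto
  have uniq: "j = i" if "phrase_start ps j \<le> p" "p \<le> phrase_end ps j" for j
    using phrase_index_unique that i by blast
  show ?case
  proof (cases "p = phrase_end ps i")
    case True
    have "h = 0" if "hop_number ps src p h" for h
      using that
    proof cases
      case (step j a b t h')
      then have "j = i" using uniq[of j] by simp
      then show ?thesis using step True by simp
    qed
    moreover have "hop_number ps src p 0" using True i hop_number.last by simp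
    ultimately show ?thesis by blast
  next
    case False
    define a where "a = phrase_start ps i"
    define t where "t = p - a"
    define b where "b = src i"
    define q where "q = b + t mod (a - b)"
    have p: "p = a + t" "a + t < phrase_end ps i"
      using i False by (simp_all add: t_def a_def)
    have "length (ps ! i) \<noteq> 1" using phrase_length[OF i(1)] p a_def by simp
    then have b: "1 \<le> b" "b < a"
      using LZ i(1) unfolding LZ_parsing_def Let_def a_def b_def phrase_start_def by force+
    then have q: "1 \<le> q" "q < a"
      using mod_less_divisor[of "a - b" t] unfolding q_def by linarith+
    then have "\<exists>!h. hop_number ps src q h" using less.IH[of q] less.prems p by simp
    then obtain h where h: "hop_number ps src q h" "\<And>h'. hop_number ps src q h' \<Longrightarrow> h' = h"
      by blast
    have "k = Suc h" if "hop_number ps src p k" for k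
      using that
    proof cases
      case (last j)
      then have "j = i" using uniq[of j] start_le by simp
      then show ?thesis using last False by simp
    next
      case (step j a' b' t' h')
      then have "j = i" using uniq[of j] by simp
      then have "a' = a" "b' = b" "t' = t" using step p by (simp_all add: a_def b_def)
      then show ?thesis using step h(2) by (simp add: q_def)
    qed
    moreover have "hop_number ps src p (Suc h)"
      using hop_number.step[of i ps a b src t h] i(1) a_def b_def p h(1) q_def by simp
    ultimately show ?thesis by blast
  qed
qed

text \<open>Splitting a string into single letters is a \<open>c\<close>-BLZ parsing, so both minima are attained.\<close>

lemma BLZ_parsing_letters: "BLZ_parsing c s (map (\<lambda>x. [x]) s) src"
proof -
  have len: "length (concat (map (\<lambda>x. [x]) xs)) = length xs" for xs :: "'a list"
    by (induction xs) auto
  have "hop_number (map (\<lambda>x. [x]) s) src p 0" if "p \<in> {1..length s}" for p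
  proof -
    have "phrase_end (map (\<lambda>x. [x]) s) (p - 1) = p"
      using that by (simp add: phrase_end_def take_map len)
    moreover have "p - 1 < length (map (\<lambda>x. [x]) s)" using that by auto
    ultimately show ?thesis
      using hop_number.last[of "p - 1" "map (\<lambda>x. [x]) s" src] by metis
  qed
  then show ?thesis by (auto simp: BLZ_parsing_def LZ_parsing_def parsing_def)
qed

end

theory Submission
  imports Defs "HOL-Computational_Algebra.Primes" "HOL-Real_Asymp.Real_Asymp"
begin

text \<open>The witnesses are the prefixes of length \<open>2 ^ n\<close> of the period-doubling sequence, whose letter
  at position \<open>p\<close> is the parity of the 2-adic valuation of \<open>p\<close>. Doubling the prefix costs one
  phrase, so they have LZ-parsings of size \<open>n + 1\<close>. On the other hand, a stretch of period \<open>d\<close>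
  has length less than \<open>5 d\<close>; hence in a parsing with \<open>k\<close> phrases the copied part of a phrase
  decomposes into at most four intervals that are translated back without overlap. By induction
  on \<open>h\<close>, an interval all of whose positions have hop-number at most \<open>h\<close> has at most
  \<open>(5 k) ^ (h + 1)\<close> positions. So a \<open>c\<close>-BLZ parsing satisfies \<open>2 ^ n \<le> (5 k) ^ (c + 1)\<close>, which
  makes \<open>k / (n + 1)\<close> unbounded.\<close>

section \<open>Period-doubling words and their dyadic LZ-parsing\<close>

text \<open>\<open>Suc\<close> turns the parities 0 and 1 into the letters 1 and 2 of the prescribed
  alphabet.\<close>

definition pd_letter :: "nat \<Rightarrow> nat" where
  "pd_letter p = Suc (multiplicity 2 p mod 2)"

definition pd_word :: "nat \<Rightarrow> nat list" where
  "pd_word n = map pd_letter [1..<Suc (2 ^ n)]"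

definition pd_phrases :: "nat \<Rightarrow> nat list list" where
  "pd_phrases n = [pd_letter 1] # map (\<lambda>k. map pd_letter [Suc (2 ^ k)..<Suc (2 ^ Suc k)]) [0..<n]"

lemma length_pd_word [simp]: "length (pd_word n) = 2 ^ n"
  by (simp add: pd_word_def)

lemma pd_word_neq_Nil [simp]: "pd_word n \<noteq> []"
  by (metis length_pd_word list.size(3) power_not_zero zero_neq_numeral)

lemma nth_pd_word: "1 \<le> p \<Longrightarrow> p \<le> 2 ^ n \<Longrightarrow> pd_word n ! (p - 1) = pd_letter p"
  by (auto simp: pd_word_def simp del: upt_Suc)

lemma set_pd_word: "set (pd_word n) \<subseteq> {1, 2, 3}"
  by (auto simp: pd_word_def pd_letter_def)

lemma concat_pd_phrases: "concat (pd_phrases n) = pd_word n"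
proof (induction n)
  case (Suc n)
  have "pd_word (Suc n) = pd_word n @ map pd_letter [Suc (2 ^ n)..<Suc (2 ^ Suc n)]"
    unfolding pd_word_def map_append[symmetric]
    using upt_add_eq_append[of 1 "Suc (2 ^ n)" "2 ^ n"] by (simp add: mult_2 del: upt_Suc)
  then show ?case using Suc by (simp add: pd_phrases_def)
qed (simp add: pd_phrases_def pd_word_def)

lemma take_pd_phrases: "i \<le> n \<Longrightarrow> take (Suc i) (pd_phrases n) = pd_phrases i"
  by (simp add: pd_phrases_def take_map)

text \<open>A valuation below \<open>i\<close> survives adding \<open>2 ^ i\<close>. At
  \<open>t = 2 ^ i\<close> it would rise by one and flip the letter; so each dyadic phrase ends
  there, on its one letter that is not copied.\<close>

lemma pd_letter_shift:
  assumes "0 < t" "t < 2 ^ i"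
  shows "pd_letter (2 ^ i + t) = pd_letter t"
proof -
  have "\<not> 2 ^ i dvd t" using assms by (auto dest: dvd_imp_le)
  then have *: "multiplicity 2 t < i"
    using assms multiplicity_dvd'[of i 2 t] by (meson not_le)
  have "multiplicity 2 (t + 2 ^ i) = multiplicity 2 t"
    using * assms by (intro multiplicity_sum_lt) (auto simp: multiplicity_same_power)
  then show ?thesis by (simp add: pd_letter_def add.commute)
qed

lemma LZ_parsing_pd: "LZ_parsing (pd_word n) (pd_phrases n) (\<lambda>_. 1)"
  unfolding LZ_parsing_def parsing_def
proof (intro conjI allI impI ballI)
  show "concat (pd_phrases n) = pd_word n" by (rule concat_pd_phrases)
  show "x \<noteq> []" if "x \<in> set (pd_phrases n)" for x
    using that by (auto simp: pd_phrases_def simp del: upt_Suc)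
  fix i assume i: "i < length (pd_phrases n)"
  show "length (pd_phrases n ! i) = 1 \<or>
    (let a = phrase_start (pd_phrases n) i; e = phrase_end (pd_phrases n) i; b = 1
     in 1 \<le> b \<and> b \<le> a - 1 \<and>
       substring (pd_word n) b (b + (e - a) - 1) = substring (pd_word n) a (e - 1))"
  proof (cases i)
    case 0
    then show ?thesis by (simp add: pd_phrases_def)
  next
    case (Suc j)
    then have j: "Suc j \<le> n" using i by (simp add: pd_phrases_def)
    have a: "phrase_start (pd_phrases n) i = Suc (2 ^ j)"
      using j Suc by (simp add: phrase_start_def take_pd_phrases concat_pd_phrases)
    have e: "phrase_end (pd_phrases n) i = 2 ^ j + 2 ^ j"
      using j Suc by (simp add: phrase_end_def take_pd_phrases concat_pd_phrases)
    have le: "(2::nat) ^ j + 2 ^ j \<le> 2 ^ n"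
      using j power_increasing[of "Suc j" n "2::nat"] by simp
    \<comment> \<open>Both sides have length \<open>2 ^ j - 1\<close>; for \<open>j = 0\<close> the
      phrase is a single letter and both are empty.\<close>
    have "substring (pd_word n) 1 (2 ^ j - 1)
        = substring (pd_word n) (Suc (2 ^ j)) (2 ^ j + 2 ^ j - 1)"
      unfolding substring_def
    proof (rule nth_equalityI)
      fix t assume "t < length (map (\<lambda>k. pd_word n ! (k - 1)) [1..<Suc (2 ^ j - 1)])"
      then have t: "Suc t < 2 ^ j" by (simp del: upt_Suc)
      have "pd_letter (Suc t) = pd_letter (2 ^ j + Suc t)"
        using pd_letter_shift[of "Suc t" j] t by simp
      moreover have "[1..<Suc (2 ^ j - 1)] ! t = 1 + t"
        "[Suc (2 ^ j)..<Suc (2 ^ j + 2 ^ j - 1)] ! t = Suc (2 ^ j) + t"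
        using t by (subst nth_upt; simp)+
      ultimately show "map (\<lambda>k. pd_word n ! (k - 1)) [1..<Suc (2 ^ j - 1)] ! t
          = map (\<lambda>k. pd_word n ! (k - 1)) [Suc (2 ^ j)..<Suc (2 ^ j + 2 ^ j - 1)] ! t"
        using t le nth_pd_word[of "Suc t" n] nth_pd_word[of "2 ^ j + Suc t" n]
        by (simp del: upt_Suc)
    qed (simp del: upt_Suc)
    then show ?thesis using a e by (simp add: Let_def)
  qed
qed

lemma OPT_LZ_pd_le: "OPT_LZ (pd_word n) \<le> Suc n"
  unfolding OPT_LZ_def
  by (rule Least_le) (use LZ_parsing_pd in \<open>force simp: pd_phrases_def\<close>)

text \<open>Keeps the denominator of the final ratio positive when it is replaced by the upper bound
  \<open>n + 1\<close>.\<close>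

lemma OPT_LZ_pos:
  assumes "s \<noteq> []"
  shows "OPT_LZ s > 0"
proof -
  have "\<exists>k ps src. LZ_parsing s ps src \<and> length ps = k"
    using BLZ_parsing_letters[of 0 s] by (auto simp: BLZ_parsing_def)
  from LeastI_ex[OF this] obtain ps src where "LZ_parsing s ps src" "length ps = OPT_LZ s"
    unfolding OPT_LZ_def by blast
  then have "ps \<noteq> []" using assms by (auto simp: LZ_parsing_def parsing_def)
  then show ?thesis using \<open>length ps = OPT_LZ s\<close> by (metis length_greater_0_conv)
qed

section \<open>Bounded repetitions in the period-doubling sequence\<close>

text \<open>Let \<open>d = 2 ^ m * u\<close> with \<open>u\<close> odd. At a position
  \<open>2 ^ m * w\<close> with \<open>w + u\<close> congruent to 2 modulo 4, adding
  \<open>d\<close> raises the valuation from \<open>m\<close> to exactly \<open>m + 1\<close>. Such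
  positions recur at distance \<open>4 * 2 ^ m\<close>, which is at most
  \<open>4 * d\<close>.\<close>

lemma pd_letter_not_periodic:
  assumes "d > 0" "b > 0"
  shows "\<exists>i \<in> {b..<b + 4 * d}. pd_letter i \<noteq> pd_letter (i + d)"
proof -
  obtain u where u: "d = 2 ^ multiplicity 2 d * u" "odd u"
    using multiplicity_decompose'[of d "2::nat"] assms by auto
  define m where "m = multiplicity 2 d"
  define P :: nat where "P = 2 ^ m"
  have d: "d = P * u" and "P > 0" "u > 0"
    using u by (auto simp: P_def m_def odd_pos)
  \<comment> \<open>The quotient of \<open>b\<close> by \<open>P\<close>, rounded up:
    \<open>P * w0\<close> is the first multiple of \<open>P\<close> from \<open>b\<close>
    on.\<close>
  define w0 where "w0 = (b + P - 1) div P"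
  have w0: "b \<le> P * w0" "P * w0 < b + P"
  proof -
    have "P * w0 + (b + P - 1) mod P = b + P - 1" unfolding w0_def by (rule mult_div_mod_eq)
    moreover have "(b + P - 1) mod P < P" using \<open>P > 0\<close> by (rule mod_less_divisor)
    ultimately show "b \<le> P * w0" "P * w0 < b + P" using assms \<open>P > 0\<close> by linarith+
  qed
  \<comment> \<open>Residue 2 makes \<open>w + u\<close> twice an odd number, and \<open>w\<close>
    odd because \<open>u\<close> is.\<close>
  obtain w where w: "w0 \<le> w" "w \<le> w0 + 3" "(w + u) mod 4 = 2"
  proof -
    have "\<exists>j\<le>3. (w0 + j + u) mod 4 = 2" by presburger
    then show thesis using that by (metis add_le_cancel_left le_add1)
  qed
  define v where "v = 2 * ((w + u) div 4) + 1"
  have v: "w + u = 2 * v" "odd v"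
    using w(3) mult_div_mod_eq[of 4 "w + u"] unfolding v_def by simp_all
  have "odd w" using v u(2) by (metis even_add even_mult_iff even_numeral)
  have val: "multiplicity 2 (2 ^ j * x) = j" if "odd x" for j x :: nat
    using that by (intro multiplicity_eqI) (auto simp: odd_pos)
  have 1: "multiplicity 2 (P * w) = m" using val \<open>odd w\<close> by (simp add: P_def)
  have "P * w + d = P * (w + u)" using d by (simp add: distrib_left)
  then have "P * w + d = 2 ^ Suc m * v" using v(1) by (simp add: P_def)
  then have 2: "multiplicity 2 (P * w + d) = Suc m" using val[OF v(2), of "Suc m"] by metis
  have "P * w \<le> P * w0 + 3 * P"
    using w(2) mult_le_mono2[of w "w0 + 3" P] by (simp add: algebra_simps)
  moreover have "P \<le> d" using d \<open>u > 0\<close> by simp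
  moreover have "P * w0 \<le> P * w" using w(1) by simp
  ultimately have "P * w \<in> {b..<b + 4 * d}" using w0 unfolding atLeastLessThan_iff by linarith
  moreover have "pd_letter (P * w) \<noteq> pd_letter (P * w + d)"
    unfolding pd_letter_def 1 2 by (simp add: mod_Suc)
  ultimately show ?thesis by blast
qed

lemma nth_substring_eq:
  assumes "substring s b (b + l - 1) = substring s a (a + l - 1)" "t < l" "1 \<le> b" "1 \<le> a"
  shows "s ! (b + t - 1) = s ! (a + t - 1)"
proof -
  have "substring s b (b + l - 1) ! t = s ! (b + t - 1)"
    "substring s a (a + l - 1) ! t = s ! (a + t - 1)"
    using assms(2-4) by (simp_all add: substring_def del: upt_Suc)
  with assms(1) show ?thesis by simp
qed

text \<open>Copying \<open>e - a\<close> letters from \<open>src i\<close> to \<open>a\<close> makes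
  letters at distance \<open>a - src i\<close> agree at \<open>e - a\<close> consecutive positions
  from \<open>src i\<close> on; \<open>pd_letter_not_periodic\<close> forbids this for four times
  that distance.\<close>

lemma pd_phrase_bound:
  assumes LZ: "LZ_parsing (pd_word n) ps src" and i: "i < length ps"
    and a: "a = phrase_start ps i" and e: "e = phrase_end ps i" and "a < e"
  shows "1 \<le> src i" "src i < a" "e - a < 4 * (a - src i)"
proof -
  define b where "b = src i"
  have "length (ps ! i) \<noteq> 1" using phrase_length[OF i] assms by simp
  then have b: "1 \<le> b" "b \<le> a - 1"
    "substring (pd_word n) b (b + (e - a) - 1) = substring (pd_word n) a (e - 1)"
    using LZ i unfolding LZ_parsing_def Let_def a e b_def by blast+
  then show 1: "1 \<le> src i" "src i < a" by (auto simp: b_def)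
  have "phrase_end ps i \<le> length (concat ps)"
    unfolding phrase_end_def
    by (metis append_take_drop_id concat_append length_append le_add1)
  then have e_le: "e \<le> 2 ^ n" using LZ e by (simp add: LZ_parsing_def parsing_def)
  have per: "pd_letter (b + t) = pd_letter (a + t)" if "t < e - a" for t
  proof -
    have "pd_word n ! (b + t - 1) = pd_word n ! (a + t - 1)"
      by (rule nth_substring_eq[of _ _ "e - a"]) (use b that in auto)
    then show ?thesis
      using nth_pd_word[of "b + t" n] nth_pd_word[of "a + t" n] b that e_le by simp
  qed
  show "e - a < 4 * (a - src i)"
  proof (rule ccontr)
    assume *: "\<not> e - a < 4 * (a - src i)"
    obtain j where j: "j \<in> {b..<b + 4 * (a - b)}" "pd_letter j \<noteq> pd_letter (j + (a - b))"
      using pd_letter_not_periodic[of "a - b" b] b 1 by (auto simp: b_def)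
    have "j - b < e - a" using * j(1) by (auto simp: b_def)
    moreover have "b + (j - b) = j" "a + (j - b) = j + (a - b)"
      using j(1) 1 by (auto simp: b_def)
    ultimately show False using per[of "j - b"] j(2) by simp
  qed
qed

section \<open>Counting positions of bounded hop-number\<close>

text \<open>Inversion at a copied position: a position lies in only one phrase, so the index in
  either rule must be \<open>i\<close>, which excludes \<open>last\<close> and fixes the source
  position.\<close>

lemma hop_number_inside_phrase:
  assumes "hop_number ps src p h" "phrase_start ps i \<le> p" "p < phrase_end ps i"
    and ne: "\<And>j. j < length ps \<Longrightarrow> ps ! j \<noteq> []"
  shows "\<exists>h'. h = Suc h' \<and>
    hop_number ps src (src i + (p - phrase_start ps i) mod (phrase_start ps i - src i)) h'"
  using assms(1)
proof cases
  case (last j)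
  have "phrase_start ps j \<le> phrase_end ps j"
    using phrase_length[OF last(3)] ne[OF last(3)] by (cases "ps ! j") auto
  then have "j = i" using last phrase_index_unique[of ps j p i] assms by simp
  then show ?thesis using last assms by simp
next
  case (step j a b t h')
  then have "j = i" using phrase_index_unique[of ps j p i] assms by simp
  then show ?thesis using step by auto
qed

text \<open>Intervals are described without endpoints, so translated pieces qualify without
  computing their bounds.\<close>

definition convex_nat :: "nat set \<Rightarrow> bool" where
  "convex_nat S \<longleftrightarrow> (\<forall>x\<in>S. \<forall>y\<in>S. {x..y} \<subseteq> S)"

text \<open>With \<open>k\<close> phrases, the maximal sizes satisfy N(h+1) \<le> k + 4k N(h) \<le>
  5k N(h): \<open>k\<close> phrase ends and \<open>4k\<close> translated pieces. Arbitrary intervals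
  are allowed because the source of a piece may lie anywhere earlier in the word.\<close>

lemma card_bounded_hop:
  assumes LZ: "LZ_parsing (pd_word n) ps src"
  shows "S \<subseteq> {1..2 ^ n} \<Longrightarrow> convex_nat S \<Longrightarrow> (\<And>p. p \<in> S \<Longrightarrow> \<exists>h'\<le>h. hop_number ps src p h')
    \<Longrightarrow> card S \<le> (5 * length ps) ^ Suc h"
proof (induction h arbitrary: S)
  case (0 S)
  have "S \<subseteq> phrase_end ps ` {..<length ps}"
  proof
    fix p assume "p \<in> S"
    then have "hop_number ps src p 0" using 0(3) by auto
    then show "p \<in> phrase_end ps ` {..<length ps}" by cases auto
  qed
  then have "card S \<le> card {..<length ps}"
    by (rule surj_card_le[rotated]) simp
  then show ?case by simp
next
  case (Suc h S)
  define B where "B = (5 * length ps) ^ Suc h"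
  have concat: "concat ps = pd_word n" and ne: "\<And>j. j < length ps \<Longrightarrow> ps ! j \<noteq> []"
    using LZ by (simp_all add: LZ_parsing_def parsing_def)
  have fin: "finite S" using Suc.prems(1) finite_subset by blast
  define b where "b = src"
  define a where "a = phrase_start ps"
  define e where "e = phrase_end ps"
  \<comment> \<open>The part of \<open>S\<close> in the \<open>q\<close>-th period of the copied
    part of phrase \<open>i\<close>. Within one period the reduction modulo \<open>a i - b i\<close>
    subtracts a constant, so the source map is a translation.\<close>
  define piece where "piece = (\<lambda>i q. {p \<in> S. a i + q * (a i - b i) \<le> p
      \<and> p < a i + Suc q * (a i - b i) \<and> p < e i})"
  have piece_le: "card (piece i q) \<le> B" if i: "i < length ps" for i q
  proof (cases "piece i q = {}")
    case False
    then have "a i < e i" by (auto simp: piece_def)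
    then have bnd: "1 \<le> b i" "b i < a i"
      using pd_phrase_bound[OF LZ i, of "a i" "e i"] by (simp_all add: a_def b_def e_def)
    define d where "d = a i - b i"
    define r where "r = a i + q * d"
    have r: "b i \<le> r" using bnd by (simp add: r_def)
    have mem: "p \<in> piece i q \<longleftrightarrow> p \<in> S \<and> r \<le> p \<and> p < r + d \<and> p < e i" for p
      by (auto simp: piece_def r_def d_def)
    \<comment> \<open>This is the source map on the piece, sending \<open>r\<close> to
      \<open>b i\<close>; each application lowers the hop-number by one.\<close>
    define f where "f p = p - (r - b i)" for p
    have inj: "inj_on f (piece i q)"
      by (rule inj_onI) (auto simp: mem f_def)
    have "card (f ` piece i q) \<le> B"
      unfolding B_def
    proof (rule Suc.IH)
      show "f ` piece i q \<subseteq> {1..2 ^ n}"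
        using Suc.prems(1) bnd r by (fastforce simp: mem f_def)
      show "convex_nat (f ` piece i q)"
        unfolding convex_nat_def
      proof (intro ballI subsetI)
        fix x' y' z assume "x' \<in> f ` piece i q" "y' \<in> f ` piece i q" and z: "z \<in> {x'..y'}"
        then obtain x y where xy: "x \<in> piece i q" "y \<in> piece i q" "x' = f x" "y' = f y" by blast
        define z' where "z' = z + (r - b i)"
        have "x \<le> z'" "z' \<le> y" using xy z r by (auto simp: z'_def f_def mem)
        moreover have "{x..y} \<subseteq> S"
          using Suc.prems(2) xy unfolding convex_nat_def mem by blast
        ultimately have "z' \<in> S" by auto
        then have "z' \<in> piece i q" using xy \<open>x \<le> z'\<close> \<open>z' \<le> y\<close> by (auto simp: mem)
        moreover have "z = f z'" by (simp add: z'_def f_def)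
        ultimately show "z \<in> f ` piece i q" by blast
      qed
      fix p' assume "p' \<in> f ` piece i q"
      then obtain p where p: "p \<in> piece i q" "p' = f p" by blast
      obtain h1 where h1: "h1 \<le> Suc h" "hop_number ps src p h1"
        using Suc.prems(3) p by (auto simp: mem)
      have "phrase_start ps i \<le> p" "p < phrase_end ps i"
        using p by (auto simp: mem r_def a_def e_def)
      from hop_number_inside_phrase[OF h1(2) this ne]
      obtain h' where h': "h1 = Suc h'" "hop_number ps src (b i + (p - a i) mod d) h'"
        by (auto simp: a_def b_def d_def)
      have "p - a i = (p - r) + q * d" "p - r < d" using p by (auto simp: mem r_def)
      then have "(p - a i) mod d = p - r" by simp
      moreover have "p' = b i + (p - r)" using p r by (auto simp: mem f_def)
      ultimately show "\<exists>h'\<le>h. hop_number ps src p' h'" using h1 h' by auto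
    qed
    then show ?thesis using card_image[OF inj] by simp
  qed simp
  \<comment> \<open>Four periods suffice by \<open>pd_phrase_bound\<close>; the phrase ends are the
    positions that are not copied.\<close>
  have "S \<subseteq> e ` {..<length ps} \<union> (\<Union>(i, q) \<in> {..<length ps} \<times> {..<4}. piece i q)"
  proof
    fix p assume p: "p \<in> S"
    then have "1 \<le> p" "p \<le> length (concat ps)" using Suc.prems(1) concat by auto
    then obtain i where i: "i < length ps" "a i \<le> p" "p \<le> e i"
      using phrase_index_exists[of p ps] by (auto simp: a_def e_def)
    show "p \<in> e ` {..<length ps} \<union> (\<Union>(i, q) \<in> {..<length ps} \<times> {..<4}. piece i q)"
    proof (cases "p = e i")
      case False
      define d where "d = a i - b i"
      have "a i < e i" using False i by simp
      then have bnd: "b i < a i" "e i - a i < 4 * d"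
        using pd_phrase_bound[OF LZ i(1), of "a i" "e i"]
        by (simp_all add: a_def b_def e_def d_def)
      define q where "q = (p - a i) div d"
      have "d > 0" using bnd by (simp add: d_def)
      have "q < 4" unfolding q_def using bnd i False
        by (intro less_mult_imp_div_less) linarith
      have "p - a i = q * d + (p - a i) mod d" unfolding q_def by simp
      moreover have "(p - a i) mod d < d" using \<open>d > 0\<close> by simp
      ultimately have "a i + q * d \<le> p" "p < a i + Suc q * d" using i by auto
      then have "p \<in> piece i q" using p i False by (simp add: piece_def d_def)
      then show ?thesis using i(1) \<open>q < 4\<close> by blast
    qed (use i in blast)
  qed
  then have "card S \<le> card (e ` {..<length ps} \<union> (\<Union>(i, q) \<in> {..<length ps} \<times> {..<4}. piece i q))"
    using fin by (intro card_mono) (auto simp: piece_def)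
  also have "\<dots> \<le> card (e ` {..<length ps})
      + card (\<Union>(i, q) \<in> {..<length ps} \<times> {..<4}. piece i q)"
    by (rule card_Un_le)
  also have "card (e ` {..<length ps}) \<le> length ps"
    using card_image_le[of "{..<length ps}" e] by simp
  also have "card (\<Union>(i, q) \<in> {..<length ps} \<times> {..<4}. piece i q)
      \<le> (\<Sum>(i, q) \<in> {..<length ps} \<times> {..<4}. card (piece i q))"
    unfolding case_prod_beta by (rule card_UN_le) simp
  also have "\<dots> \<le> (\<Sum>(i, q) \<in> {..<length ps} \<times> {..<4::nat}. B)"
    by (rule sum_mono) (auto simp: piece_le)
  also have "\<dots> = 4 * length ps * B" by simp
  \<comment> \<open>Since \<open>B\<close> is at least 1 when there are phrases, the phrase ends are
    absorbed into one more summand \<open>length ps * B\<close>.\<close>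
  also have "length ps + 4 * length ps * B \<le> 5 * length ps * B"
  proof (cases "length ps = 0")
    case False
    then have "1 \<le> 5 * length ps" by linarith
    then have "B \<ge> 1" unfolding B_def by (rule one_le_power)
    then show ?thesis using mult_le_mono2[of 1 B "length ps"] by simp
  qed simp
  finally show ?case by (simp add: B_def)
qed

text \<open>Apply \<open>card_bounded_hop\<close> to an optimal parsing, with the whole word as the
  interval.\<close>

lemma OPT_BLZ_pd_ge: "2 ^ n \<le> (5 * OPT_BLZ c (pd_word n)) ^ Suc c"
proof -
  have "\<exists>k ps src. BLZ_parsing c (pd_word n) ps src \<and> length ps = k"
    using BLZ_parsing_letters by blast
  from LeastI_ex[OF this] obtain ps src where "BLZ_parsing c (pd_word n) ps src"
    and len: "length ps = OPT_BLZ c (pd_word n)"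
    unfolding OPT_BLZ_def by blast
  then have "card {1..2 ^ n :: nat} \<le> (5 * length ps) ^ Suc c"
    by (intro card_bounded_hop) (auto simp: BLZ_parsing_def convex_nat_def)
  then show ?thesis using len by simp
qed

section \<open>Asymptotic comparison and conclusion\<close>

lemma exponential_dominates:
  fixes A :: real
  shows "\<exists>n. (A * (real n + 1)) ^ k < 2 ^ n"
proof -
  have "(\<lambda>n. A ^ k * ((real n + 1) ^ k / 2 ^ n)) \<longlonglongrightarrow> A ^ k * 0"
    by (intro tendsto_mult tendsto_const) real_asymp
  then have "eventually (\<lambda>n. A ^ k * ((real n + 1) ^ k / 2 ^ n) < 1) sequentially"
    by (rule order_tendstoD) simp
  then obtain n where "A ^ k * ((real n + 1) ^ k / 2 ^ n) < 1"
    using eventually_happens'[of sequentially] by auto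
  then have "(A * (real n + 1)) ^ k < 2 ^ n" by (simp add: power_mult_distrib divide_less_eq)
  then show ?thesis by blast
qed

theorem theorem5:
  fixes c :: nat
  assumes "c \<ge> 1"
  shows "\<forall>M::real. \<exists>s::nat list. s \<noteq> [] \<and> set s \<subseteq> {1, 2, 3} \<and>
           real (OPT_BLZ c s) / real (OPT_LZ s) > M"
proof
  fix M :: real
  obtain n where n: "(5 * M * (real n + 1)) ^ Suc c < 2 ^ n"
    using exponential_dominates by blast
  define K where "K = OPT_BLZ c (pd_word n)"
  have "real (2 ^ n) \<le> real ((5 * K) ^ Suc c)"
    unfolding of_nat_le_iff K_def by (rule OPT_BLZ_pd_ge)
  then have "(2::real) ^ n \<le> (5 * real K) ^ Suc c" by simp
  then have "(5 * M * (real n + 1)) ^ Suc c < (5 * real K) ^ Suc c" using n by linarith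
  \<comment> \<open>Only the right-hand base has to be nonnegative, so a negative \<open>M\<close>
    needs no separate case.\<close>
  then have "5 * M * (real n + 1) < 5 * real K" by (rule power_less_imp_less_base) simp
  then have "M < real K / (real n + 1)" by (simp add: field_simps)
  also have "\<dots> \<le> real K / real (OPT_LZ (pd_word n))"
    using OPT_LZ_pd_le[of n] OPT_LZ_pos[of "pd_word n"] by (intro divide_left_mono) auto
  finally show "\<exists>s::nat list. s \<noteq> [] \<and> set s \<subseteq> {1, 2, 3} \<and>
      real (OPT_BLZ c s) / real (OPT_LZ s) > M"
    using set_pd_word[of n] pd_word_neq_Nil[of n] unfolding K_def by blast
qed

end
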